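(* Let $N\ge 1$, let $\mathscr{P}=\{\mathbf{P}_{0}=\mathbf{p}_{0}\cdot\mu,\ldots,\mathbf{P}_{N}=\mathbf{p}_{N}\cdot\mu\}$ be a family of $N+1$ distinct probabilities dominated by a measure $\mu$ on a measurable space $(\mathbf{E},\mathcal{E})$, put $\mathcal{J}=\{0,\ldots,N\}$, and let $$\overline{\mathcal{B}}(\mathscr{P})=\sup_{\widehat T}\ \frac{1}{N+1}\sum_{j=0}^{N}\mathbf{P}_{j}\left[\widehat T(\boldsymbol{X})=j\right],$$ where the supremum runs over all estimators $\widehat T(\boldsymbol{X})$ with values in $\mathcal{J}$. For any probability $\mathbf{Q}=\mathbf{q}\cdot\mu$ that dominates $\mathscr{P}$, $$1\le (N+1)\,\overline{\mathcal{B}}(\mathscr{P})=\mathbb{E}_{\mathbf{Q}}\left[\max_{j\in\mathcal{J}}\frac{\mathbf{p}_{j}}{\mathbf{q}}(\boldsymbol{X})\right],$$ where $\mathbb{E}_{\mathbf{Q}}$ denotes the expectation when $\boldsymbol{X}$ has distribution $\mathbf{Q}$. Moreover, for any function $\varphi$ that is convex, non-decreasing and non-negative on $\mathbb{R}_{+}$, $$\varphi\left((N+1)\,\overline{\mathcal{B}}(\mathscr{P})\right)\le \sum_{j=0}^{N}\mathbb{E}_{\mathbf{Q}}\left[\varphi\left(\frac{\mathbf{p}_{j}}{\mathbf{q}}(\boldsymbol{X})\right)\right].$$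
   Context: The notation $\mathbf{P}=\mathbf{p}\cdot\mu$ means that $\mathbf{P}$ is the probability on $(\mathbf{E},\mathcal{E})$ with density $\mathbf{p}$ with respect to $\mu$. The observation $\boldsymbol{X}$ takes its values in $\mathbf{E}$, and $\mathbf{P}_{j}[\widehat T(\boldsymbol{X})=j]$ is the probability of the event when $\boldsymbol{X}$ has distribution $\mathbf{P}_{j}$. An estimator with values in $\mathcal{J}$ is a measurable function $\widehat T:\mathbf{E}\to\mathcal{J}$ evaluated at $\boldsymbol{X}$. The probability $\mathbf{Q}$ dominates $\mathscr{P}$ if $\mathbf{P}_{j}\ll\mathbf{Q}$ for all $j\in\mathcal{J}$. The ratio $\mathbf{p}_{j}/\mathbf{q}$ is considered on the set $\{\mathbf{q}>0\}$, which has $\mathbf{Q}$-probability 1. Expectations of non-negative quantities may equal $+\infty$. $\mathbb{R}_{+}=[0,+\infty)$. *)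

theory Defs
  imports "HOL-Probability.Probability"
begin

(* Only the measurable space underlying E matters. Estimators are the measurable maps from it into
   {0..N} with the discrete sigma-algebra, and X is the identity on E. If every P j is a probability, the supremum is over a
   nonempty set of reals in [0,1], so the real-valued SUP is the genuine supremum. *)
definition bayes_accuracy :: "'a measure \<Rightarrow> nat \<Rightarrow> (nat \<Rightarrow> 'a measure) \<Rightarrow> real" where
  "bayes_accuracy E N P =
     (SUP T \<in> measurable E (count_space {0..N}).
        1 / (real N + 1) * (\<Sum>j=0..N. measure (P j) {x \<in> space E. T x = j}))"

end

theory Submission imports Defs begin

text \<open>
  Write \<open>r j = p j / q\<close>. Domination of \<open>P j\<close> by \<open>Q\<close> means that \<open>P j\<close> does not charge
  \<open>{q = 0}\<close>, so \<open>r j\<close> is a density of \<open>P j\<close> with respect to \<open>Q\<close> and \<open>\<mu>\<close> can be forgotten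
  (\<open>density_quotient\<close>). For an estimator \<open>T\<close> the events \<open>{T = j}\<close> partition the space, hence
  the sum of the probabilities \<open>P j {T = j}\<close> is the \<open>Q\<close>-integral of the single function
  \<open>x \<mapsto> r (T x) x\<close> (\<open>sum_measure_decision_regions\<close>). Its integrand is at most the maximum of
  the likelihood ratios, with equality when \<open>T\<close> picks a maximising index, which can be done
  measurably (\<open>measurable_argmax_exists\<close>). This gives the formula for the optimal accuracy
  (\<open>bayes_accuracy_eq_nn_integral_Max\<close>), and the lower bound because the maximum dominates
  \<open>r 0\<close>, whose integral is 1.

  The last inequality is Jensen's inequality for the maximum, followed by the bound of
  \<open>\<phi> (Max\<^sub>j r j)\<close> by the sum of the non-negative numbers \<open>\<phi> (r j)\<close>, one of which it equals.
\<close>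

text \<open>
  The two densities multiply to \<open>p\<close> wherever \<open>q > 0\<close>. On \<open>{q = 0}\<close> the product is 0, and absolute
  continuity makes \<open>p\<close> vanish there almost everywhere as well.
\<close>

lemma density_quotient:
  fixes p q :: "'a \<Rightarrow> real"
  assumes [measurable]: "p \<in> borel_measurable \<mu>" "q \<in> borel_measurable \<mu>"
    and p: "\<And>x. x \<in> space \<mu> \<Longrightarrow> 0 \<le> p x" and q: "\<And>x. x \<in> space \<mu> \<Longrightarrow> 0 \<le> q x"
    and ac: "absolutely_continuous (density \<mu> (\<lambda>x. ennreal (q x))) (density \<mu> (\<lambda>x. ennreal (p x)))"
  shows "density \<mu> (\<lambda>x. ennreal (p x))
       = density (density \<mu> (\<lambda>x. ennreal (q x))) (\<lambda>x. ennreal (p x / q x))"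
proof -
  define Z where "Z = {x \<in> space \<mu>. q x = 0}"
  have [measurable]: "Z \<in> sets \<mu>" unfolding Z_def by measurable
  have "emeasure (density \<mu> (\<lambda>x. ennreal (q x))) Z = (\<integral>\<^sup>+x. 0 \<partial>\<mu>)"
    by (subst emeasure_density) (auto simp: Z_def indicator_def simp del: nn_integral_const intro!: nn_integral_cong)
  then have "Z \<in> null_sets (density \<mu> (\<lambda>x. ennreal (q x)))"
    by (auto simp: null_sets_def)
  with ac have "Z \<in> null_sets (density \<mu> (\<lambda>x. ennreal (p x)))"
    by (auto simp: absolutely_continuous_def)
  then have "AE x in \<mu>. x \<in> Z \<longrightarrow> ennreal (p x) = 0"
    by (simp add: null_sets_density_iff)
  then have "AE x in \<mu>. ennreal (p x) = ennreal (q x) * ennreal (p x / q x)"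
    using AE_space
  proof eventually_elim
    case (elim x)
    then show ?case
      using p[of x] q[of x] by (auto simp: Z_def ennreal_mult[symmetric])
  qed
  then have "density \<mu> (\<lambda>x. ennreal (p x)) = density \<mu> (\<lambda>x. ennreal (q x) * ennreal (p x / q x))"
    by (intro density_cong) auto
  also have "\<dots> = density (density \<mu> (\<lambda>x. ennreal (q x))) (\<lambda>x. ennreal (p x / q x))"
    by (intro density_density_eq[symmetric]) auto
  finally show ?thesis .
qed

text \<open>Choosing the least maximising index makes the choice measurable.\<close>

lemma measurable_argmax_exists:
  fixes r :: "nat \<Rightarrow> 'a \<Rightarrow> real"
  assumes r: "\<And>j. j \<le> N \<Longrightarrow> r j \<in> borel_measurable M"
  obtains T where "T \<in> measurable M (count_space {0..N})"
    and "\<And>x. r (T x) x = Max ((\<lambda>j. r j x) ` {0..N})"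
proof
  define T where "T x = (LEAST j. j \<le> N \<and> (\<forall>i\<in>{0..N}. r i x \<le> r j x))" for x
  have ex: "\<exists>j. j \<le> N \<and> (\<forall>i\<in>{0..N}. r i x \<le> r j x)" for x
  proof -
    have "Max ((\<lambda>j. r j x) ` {0..N}) \<in> (\<lambda>j. r j x) ` {0..N}"
      by (intro Max_in) auto
    then obtain j where j: "j \<le> N" "Max ((\<lambda>j. r j x) ` {0..N}) = r j x"
      by (metis (no_types, lifting) imageE atLeastAtMost_iff)
    have "\<forall>i\<in>{0..N}. r i x \<le> r j x"
      unfolding j(2)[symmetric] by (auto intro!: Max_ge)
    with j show ?thesis by blast
  qed
  have T: "T x \<le> N \<and> (\<forall>i\<in>{0..N}. r i x \<le> r (T x) x)" for x
    unfolding T_def by (rule LeastI_ex[OF ex])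
  show "r (T x) x = Max ((\<lambda>j. r j x) ` {0..N})" for x
    using T[of x] by (intro Max_eqI[symmetric]) auto
  have "Measurable.pred M (\<lambda>x. j \<le> N \<and> (\<forall>i\<in>{0..N}. r i x \<le> r j x))" for j
  proof (cases "j \<le> N")
    case True
    have "Measurable.pred M (\<lambda>x. r i x \<le> r j x)" if "i \<in> {0..N}" for i
      using r[OF True] r[of i] that by simp
    then have "Measurable.pred M (\<lambda>x. \<forall>i\<in>{0..N}. r i x \<le> r j x)"
      by (intro pred_intros_finite) auto
    with True show ?thesis by simp
  qed simp
  then have "T \<in> measurable M (count_space UNIV)"
    unfolding T_def by (rule measurable_Least)
  then show "T \<in> measurable M (count_space {0..N})"
    using T by (simp add: measurable_count_space_eq2_countable)
qed

text \<open>The decision regions partition the space, so at each point exactly one density contributes.\<close>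

lemma sum_measure_decision_regions:
  fixes r :: "nat \<Rightarrow> 'a \<Rightarrow> real"
  assumes r: "\<And>j. j \<le> N \<Longrightarrow> r j \<in> borel_measurable M"
    and P: "\<And>j. j \<le> N \<Longrightarrow> P j = density M (\<lambda>x. ennreal (r j x))"
    and fin: "\<And>j. j \<le> N \<Longrightarrow> finite_measure (P j)"
    and T: "T \<in> measurable M (count_space {0..N})"
  shows "ennreal (\<Sum>j=0..N. measure (P j) {x \<in> space M. T x = j})
       = (\<integral>\<^sup>+x. ennreal (r (T x) x) \<partial>M)"
proof -
  have A: "{x \<in> space M. T x = j} \<in> sets M" if "j \<in> {0..N}" for j
    using T that by (auto simp: measurable_count_space_eq2 vimage_def Int_def conj_commute)
  have "ennreal (\<Sum>j=0..N. measure (P j) {x \<in> space M. T x = j})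
      = (\<Sum>j=0..N. ennreal (measure (P j) {x \<in> space M. T x = j}))"
    by (simp add: sum_ennreal)
  also have "\<dots> = (\<Sum>j=0..N. \<integral>\<^sup>+x. ennreal (r j x) * indicator {x \<in> space M. T x = j} x \<partial>M)"
  proof (intro sum.cong refl)
    fix j assume j: "j \<in> {0..N}"
    then have "ennreal (measure (P j) {x \<in> space M. T x = j}) = emeasure (P j) {x \<in> space M. T x = j}"
      using fin[of j] by (simp add: finite_measure.emeasure_eq_measure)
    also have "\<dots> = (\<integral>\<^sup>+x. ennreal (r j x) * indicator {x \<in> space M. T x = j} x \<partial>M)"
      using j r[of j] A[OF j] by (simp add: P emeasure_density)
    finally show "ennreal (measure (P j) {x \<in> space M. T x = j}) = \<dots>" .
  qed
  also have "\<dots> = (\<integral>\<^sup>+x. (\<Sum>j=0..N. ennreal (r j x) * indicator {x \<in> space M. T x = j} x) \<partial>M)"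
    using r A by (intro nn_integral_sum[symmetric]) auto
  also have "\<dots> = (\<integral>\<^sup>+x. ennreal (r (T x) x) \<partial>M)"
  proof (intro nn_integral_cong)
    fix x assume x: "x \<in> space M"
    have "(\<Sum>j=0..N. ennreal (r j x) * indicator {x \<in> space M. T x = j} x)
        = (\<Sum>j=0..N. if T x = j then ennreal (r j x) else 0)"
      using x by (intro sum.cong) auto
    also have "\<dots> = ennreal (r (T x) x)"
      using measurable_space[OF T x] by simp
    finally show "(\<Sum>j=0..N. ennreal (r j x) * indicator {x \<in> space M. T x = j} x)
        = ennreal (r (T x) x)" .
  qed
  finally show ?thesis .
qed

text \<open>The supremum over all estimators is a maximum, attained by choosing a most likely index.\<close>

lemma bayes_accuracy_eq_nn_integral_Max:
  fixes r :: "nat \<Rightarrow> 'a \<Rightarrow> real"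
  assumes r: "\<And>j. j \<le> N \<Longrightarrow> r j \<in> borel_measurable M"
    and P: "\<And>j. j \<le> N \<Longrightarrow> P j = density M (\<lambda>x. ennreal (r j x))"
    and fin: "\<And>j. j \<le> N \<Longrightarrow> finite_measure (P j)"
  shows "ennreal ((real N + 1) * bayes_accuracy M N P)
       = (\<integral>\<^sup>+x. ennreal (Max ((\<lambda>j. r j x) ` {0..N})) \<partial>M)"
proof -
  let ?S = "\<lambda>T. \<Sum>j=0..N. measure (P j) {x \<in> space M. T x = j}"
  obtain T0 where T0: "T0 \<in> measurable M (count_space {0..N})"
    and T0_max: "\<And>x. r (T0 x) x = Max ((\<lambda>j. r j x) ` {0..N})"
    using measurable_argmax_exists[of N r M, OF r] by blast
  have S: "ennreal (?S T) = (\<integral>\<^sup>+x. ennreal (r (T x) x) \<partial>M)"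
    if "T \<in> measurable M (count_space {0..N})" for T
    using r P fin that by (rule sum_measure_decision_regions)
  have le: "?S T \<le> ?S T0" if T: "T \<in> measurable M (count_space {0..N})" for T
  proof -
    have "ennreal (?S T) \<le> ennreal (?S T0)"
      unfolding S[OF T] S[OF T0] T0_max
      using measurable_space[OF T] by (intro nn_integral_mono ennreal_leI Max_ge) auto
    then show ?thesis
      by (subst (asm) ennreal_le_iff) (simp_all only: sum_nonneg measure_nonneg)
  qed
  have "bayes_accuracy M N P = 1 / (real N + 1) * ?S T0"
    unfolding bayes_accuracy_def using T0 le
    by (intro cSup_eq_maximum) (auto intro!: divide_right_mono)
  then show ?thesis
    using S[OF T0] by (simp add: T0_max)
qed

text \<open>
  The classical Jensen inequality asks for an open interval, while \<open>X\<close> may take the value 0 and \<open>\<phi>\<close> is only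
  controlled on the closed half-line. The function \<open>t \<mapsto> \<phi> (max 0 t)\<close> is convex on the whole
  line because \<open>\<phi>\<close> is convex and monotone, and it is measurable because it is monotone.
  The right-hand side is an extended real: it is infinite exactly when \<open>\<phi> \<circ> X\<close> is not integrable.
\<close>

lemma (in prob_space) jensens_inequality_mono_nonneg:
  fixes X :: "'a \<Rightarrow> real" and \<phi> :: "real \<Rightarrow> real"
  assumes X: "integrable M X" and X0: "\<And>x. x \<in> space M \<Longrightarrow> 0 \<le> X x"
    and cvx: "convex_on {0..} \<phi>" and mono: "mono_on {0..} \<phi>" and nonneg: "\<And>t. 0 \<le> t \<Longrightarrow> 0 \<le> \<phi> t"
  shows "ennreal (\<phi> (expectation X)) \<le> (\<integral>\<^sup>+x. ennreal (\<phi> (X x)) \<partial>M)"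
proof -
  define \<psi> where "\<psi> t = \<phi> (max 0 t)" for t
  have mono_\<psi>: "mono \<psi>"
    unfolding \<psi>_def by (intro monoI mono_onD[OF mono]) auto
  have [measurable]: "\<psi> \<in> borel_measurable borel"
    using mono_\<psi> by (rule borel_measurable_mono)
  have [measurable]: "X \<in> borel_measurable M"
    using X by auto
  have cvx_\<psi>: "convex_on UNIV \<psi>"
  proof (rule convex_onI)
    fix t x y :: real assume t: "0 < t" "t < 1"
    have "max 0 ((1 - t) * x + t * y) \<le> (1 - t) * max 0 x + t * max 0 y"
      using t by (intro max.boundedI add_mono mult_left_mono add_nonneg_nonneg mult_nonneg_nonneg) auto
    then have "\<psi> ((1 - t) * x + t * y) \<le> \<phi> ((1 - t) * max 0 x + t * max 0 y)"
      unfolding \<psi>_def by (intro mono_onD[OF mono]) auto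
    also have "\<dots> \<le> (1 - t) * \<psi> x + t * \<psi> y"
      unfolding \<psi>_def using convex_onD[OF cvx, of t "max 0 x" "max 0 y"] t by simp
    finally show "\<psi> ((1 - t) *\<^sub>R x + t *\<^sub>R y) \<le> (1 - t) * \<psi> x + t * \<psi> y"
      by simp
  qed simp
  have "(\<integral>\<^sup>+x. ennreal (\<phi> (X x)) \<partial>M) = (\<integral>\<^sup>+x. ennreal (\<psi> (X x)) \<partial>M)"
    using X0 by (intro nn_integral_cong) (simp add: \<psi>_def)
  moreover have "\<phi> (expectation X) = \<psi> (expectation X)"
    using X0 by (simp add: \<psi>_def)
  moreover have "ennreal (\<psi> (expectation X)) \<le> (\<integral>\<^sup>+x. ennreal (\<psi> (X x)) \<partial>M)"
  proof (cases "integrable M (\<lambda>x. \<psi> (X x))")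
    case True
    have "\<psi> (expectation X) \<le> expectation (\<lambda>x. \<psi> (X x))"
      using True X cvx_\<psi> by (intro jensens_inequality[where I = UNIV]) auto
    then show ?thesis
      using True nonneg by (subst nn_integral_eq_integral) (auto simp: \<psi>_def intro: ennreal_leI)
  next
    case False
    moreover have "integrable M (\<lambda>x. \<psi> (X x))" if "(\<integral>\<^sup>+x. ennreal (\<psi> (X x)) \<partial>M) < \<infinity>"
    proof (rule integrableI_nonneg[OF _ _ that])
      show "(\<lambda>x. \<psi> (X x)) \<in> borel_measurable M"
        by measurable
      show "AE x in M. 0 \<le> \<psi> (X x)"
        using nonneg unfolding \<psi>_def by (intro AE_I2) simp
    qed
    ultimately have "(\<integral>\<^sup>+x. ennreal (\<psi> (X x)) \<partial>M) = \<infinity>"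
      by (metis infinity_ennreal_def less_top)
    then show ?thesis by simp
  qed
  ultimately show ?thesis by simp
qed

theorem theorem1:
  fixes \<mu> Q :: "'a measure" and P :: "nat \<Rightarrow> 'a measure"
    and p :: "nat \<Rightarrow> 'a \<Rightarrow> real" and q :: "'a \<Rightarrow> real" and N :: nat
  assumes "N \<ge> 1"
    and "\<And>j. j \<le> N \<Longrightarrow> p j \<in> borel_measurable \<mu>"
    and "\<And>j x. j \<le> N \<Longrightarrow> x \<in> space \<mu> \<Longrightarrow> 0 \<le> p j x"
    and "\<And>j. j \<le> N \<Longrightarrow> P j = density \<mu> (\<lambda>x. ennreal (p j x))"
    and "\<And>j. j \<le> N \<Longrightarrow> prob_space (P j)"
    and "inj_on P {0..N}"
    and "q \<in> borel_measurable \<mu>"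
    and "\<And>x. x \<in> space \<mu> \<Longrightarrow> 0 \<le> q x"
    and "Q = density \<mu> (\<lambda>x. ennreal (q x))"
    and "prob_space Q"
    and "\<And>j. j \<le> N \<Longrightarrow> absolutely_continuous Q (P j)"
  shows "1 \<le> (real N + 1) * bayes_accuracy \<mu> N P
    \<and> ennreal ((real N + 1) * bayes_accuracy \<mu> N P)
        = (\<integral>\<^sup>+x. ennreal (Max ((\<lambda>j. p j x / q x) ` {0..N})) \<partial>Q)
    \<and> (\<forall>\<phi> :: real \<Rightarrow> real.
         convex_on {0..} \<phi> \<longrightarrow> mono_on {0..} \<phi> \<longrightarrow> (\<forall>t\<ge>0. 0 \<le> \<phi> t) \<longrightarrow>
           ennreal (\<phi> ((real N + 1) * bayes_accuracy \<mu> N P))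
             \<le> (\<Sum>j=0..N. \<integral>\<^sup>+x. ennreal (\<phi> (p j x / q x)) \<partial>Q))"
proof -
  define r where "r j x = p j x / q x" for j x
  define B where "B = (real N + 1) * bayes_accuracy \<mu> N P"
  define X where "X x = Max ((\<lambda>j. r j x) ` {0..N})" for x
  interpret Q: prob_space Q by fact
  have sets_Q [measurable_cong]: "sets Q = sets \<mu>" and space_Q: "space Q = space \<mu>"
    by (simp_all add: assms(9))
  have r_meas: "r j \<in> borel_measurable Q" if "j \<le> N" for j
    using assms(2)[OF that] assms(7) unfolding r_def by measurable
  have r_nonneg: "0 \<le> r j x" if "j \<le> N" "x \<in> space Q" for j x
    using that assms(3,8) by (simp add: r_def space_Q)
  have r_le_X: "r j x \<le> X x" if "j \<le> N" for j x
    using that unfolding X_def by (intro Max_ge) auto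
  have X_nonneg: "0 \<le> X x" if "x \<in> space Q" for x
    using r_nonneg[of 0 x] r_le_X[of 0 x] that by simp
  have X_meas: "X \<in> borel_measurable Q"
    unfolding X_def using r_meas by (intro borel_measurable_Max) auto
  have P: "P j = density Q (\<lambda>x. ennreal (r j x))" if j: "j \<le> N" for j
    unfolding assms(4)[OF j] assms(9) r_def
    using assms(11)[OF j] j
    by (intro density_quotient assms(2,3,7,8)) (simp_all add: assms(4,9))
  have fin: "finite_measure (P j)" if "j \<le> N" for j
    using assms(5)[OF that] by (simp add: prob_space.finite_measure)
  have B: "ennreal B = (\<integral>\<^sup>+x. ennreal (X x) \<partial>Q)"
  proof -
    have "bayes_accuracy \<mu> N P = bayes_accuracy Q N P"
      unfolding bayes_accuracy_def space_Q measurable_cong_sets[OF sets_Q refl] ..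
    then show ?thesis
      unfolding B_def X_def using bayes_accuracy_eq_nn_integral_Max[OF r_meas P fin] by simp
  qed
  have B_ge_1: "1 \<le> B"
  proof -
    have "1 = emeasure (P 0) (space (P 0))"
      using assms(5)[of 0] by (simp add: prob_space.emeasure_space_1)
    also have "\<dots> = (\<integral>\<^sup>+x. ennreal (r 0 x) \<partial>Q)"
      using r_meas[of 0] by (simp add: P emeasure_density cong: nn_integral_cong)
    also have "\<dots> \<le> ennreal B"
      unfolding B by (intro nn_integral_mono ennreal_leI r_le_X) simp
    finally show ?thesis
      by (simp add: ennreal_ge_1)
  qed
  have X_int: "integrable Q X"
    using X_meas X_nonneg B[symmetric] by (intro integrableI_nonneg) auto
  have B_eq: "B = Q.expectation X"
    using B B_ge_1 X_nonneg X_meas by (simp add: integral_eq_nn_integral B[symmetric])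
  have "ennreal (\<phi> B) \<le> (\<Sum>j=0..N. \<integral>\<^sup>+x. ennreal (\<phi> (r j x)) \<partial>Q)"
    if cvx: "convex_on {0..} \<phi>" and mono: "mono_on {0..} \<phi>" and nonneg: "\<forall>t\<ge>0. 0 \<le> \<phi> t"
    for \<phi> :: "real \<Rightarrow> real"
  proof -
    have \<phi>r_meas: "(\<lambda>x. ennreal (\<phi> (r j x))) \<in> borel_measurable Q" if j: "j \<le> N" for j
    proof -
      \<comment> \<open>\<open>\<phi>\<close> is only known to be monotone on the half-line where \<open>r j\<close> takes its values\<close>
      have "mono (\<lambda>t. \<phi> (max 0 t))"
        by (intro monoI mono_onD[OF mono]) auto
      then have "(\<lambda>x. ennreal (\<phi> (max 0 (r j x)))) \<in> borel_measurable Q"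
        using measurable_compose[OF r_meas[OF j] borel_measurable_mono] by simp
      then show ?thesis
        using r_nonneg[OF j] by (subst measurable_cong[where g = "\<lambda>x. ennreal (\<phi> (max 0 (r j x)))"]) auto
    qed
    have "ennreal (\<phi> B) \<le> (\<integral>\<^sup>+x. ennreal (\<phi> (X x)) \<partial>Q)"
      unfolding B_eq using X_int X_nonneg cvx mono nonneg
      by (intro Q.jensens_inequality_mono_nonneg) auto
    also have "\<dots> \<le> (\<integral>\<^sup>+x. (\<Sum>j=0..N. ennreal (\<phi> (r j x))) \<partial>Q)"
    proof (intro nn_integral_mono)
      fix x
      have "X x \<in> (\<lambda>j. r j x) ` {0..N}"
        unfolding X_def by (intro Max_in) auto
      then obtain j where "j \<in> {0..N}" "X x = r j x"
        by auto
      then show "ennreal (\<phi> (X x)) \<le> (\<Sum>j=0..N. ennreal (\<phi> (r j x)))"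
        using member_le_sum[of j "{0..N}" "\<lambda>j. ennreal (\<phi> (r j x))"] by simp
    qed
    also have "\<dots> = (\<Sum>j=0..N. \<integral>\<^sup>+x. ennreal (\<phi> (r j x)) \<partial>Q)"
      using \<phi>r_meas by (intro nn_integral_sum) simp
    finally show ?thesis .
  qed
  with B_ge_1 B show ?thesis
    unfolding B_def X_def r_def by blast
qed

end
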